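(* Let $h\ge 1$ and let $a_1,\dots,a_h$ be non-zero integers, and let $\mathscr{L}$ denote the linear form $a_1x_1+\cdots+a_hx_h$. (i) There exists a unique representation $\mathscr{L}$-basis (that is, a set $A\subseteq\mathbb{Z}$ with $f_{A,\mathscr{L}}(n)=1$ for every $n\in\mathbb{Z}$) if and only if $\mathscr{L}$ is primitive, i.e. $\gcd(a_1,\dots,a_h)=1$. (ii) The following are equivalent: (a) $\mathscr{L}$ is primitive and not all of the $a_i$ have the same sign; (b) for every $n\in\mathbb{Z}$ there exists a unique representation $\mathscr{L}$-basis $A(n)$ with $A(n)\subseteq[n,+\infty)$.
   Context: For $A\subseteq\mathbb{Z}$ and $n\in\mathbb{Z}$, a representation of $n$ by $\mathscr{L}$ (in $A$) is an $h$-tuple $(x_1,\dots,x_h)\in A^h$ with $a_1x_1+\cdots+a_hx_h=n$. Two representations $(x_1,\dots,x_h)$ and $(y_1,\dots,y_h)$ of the same integer $n$ are called equivalent if for every $\xi\in\mathbb{Z}$, $\sum_{i:\,x_i=\xi}a_i=\sum_{i:\,y_i=\xi}a_i$. The (unordered) representation function $f_{A,\mathscr{L}}(n)\in\mathbb{N}_0\cup\{\infty\}$ is the number of equivalence classes of representations of $n$ by $\mathscr{L}$ in $A$. *)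

theory Defs
  imports Complex_Main "HOL-Library.FuncSet" "HOL-Library.Extended_Nat"
begin

text \<open>A linear form in \<open>h\<close> variables is given by its coefficients \<open>a i\<close>, \<open>i \<in> {1..h}\<close>; the values
  of \<open>a\<close> at other indices are irrelevant. An \<open>h\<close>-tuple over \<open>A\<close> is an extensional function in
  \<open>{1..h} \<rightarrow>\<^sub>E A\<close>, so that distinct functions are distinct tuples.\<close>

definition representations :: "nat \<Rightarrow> (nat \<Rightarrow> int) \<Rightarrow> int set \<Rightarrow> int \<Rightarrow> (nat \<Rightarrow> int) set" where
  "representations h a A n = {x \<in> {1..h} \<rightarrow>\<^sub>E A. (\<Sum>i=1..h. a i * x i) = n}"

definition equiv_representations :: "nat \<Rightarrow> (nat \<Rightarrow> int) \<Rightarrow> (nat \<Rightarrow> int) \<Rightarrow> (nat \<Rightarrow> int) \<Rightarrow> bool" where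
  "equiv_representations h a x y \<longleftrightarrow>
     (\<forall>\<xi>::int. (\<Sum>i | i \<in> {1..h} \<and> x i = \<xi>. a i) = (\<Sum>i | i \<in> {1..h} \<and> y i = \<xi>. a i))"

definition representation_rel ::
    "nat \<Rightarrow> (nat \<Rightarrow> int) \<Rightarrow> int set \<Rightarrow> int \<Rightarrow> ((nat \<Rightarrow> int) \<times> (nat \<Rightarrow> int)) set" where
  "representation_rel h a A n =
     {(x, y). x \<in> representations h a A n \<and> y \<in> representations h a A n \<and>
              equiv_representations h a x y}"

lemma equiv_representation_rel:
  "equiv (representations h a A n) (representation_rel h a A n)"
  by (rule equivI)
     (auto simp: refl_on_def sym_def trans_def representation_rel_def equiv_representations_def)

definition representation_function :: "nat \<Rightarrow> (nat \<Rightarrow> int) \<Rightarrow> int set \<Rightarrow> int \<Rightarrow> enat" where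
  "representation_function h a A n =
     (let Q = representations h a A n // representation_rel h a A n
      in if finite Q then enat (card Q) else \<infinity>)"

definition unique_representation_basis :: "nat \<Rightarrow> (nat \<Rightarrow> int) \<Rightarrow> int set \<Rightarrow> bool" where
  "unique_representation_basis h a A \<longleftrightarrow> (\<forall>n. representation_function h a A n = 1)"

definition primitive_form :: "nat \<Rightarrow> (nat \<Rightarrow> int) \<Rightarrow> bool" where
  "primitive_form h a \<longleftrightarrow> Gcd (a ` {1..h}) = 1"

end

theory Submission
  imports Defs "HOL-Library.Nat_Bijection"
begin

text \<open>
  The basis is built greedily. Starting from a singleton, keep a finite nonempty set \<open>A\<close> on which
  inequivalent tuples have different values; while some \<open>n\<close> is not represented, adjoin the entries of
  a generic integer solution \<open>x\<close> of \<open>a\<^sub>1 x\<^sub>1 + \<dots> + a\<^sub>h x\<^sub>h = n\<close>. By genericity, a coincidence between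
  two tuples over the enlarged set is a formal identity up to adding \<open>c\<close> times this equation, for
  some integer \<open>c\<close>, without loss of generality \<open>c \<ge> 0\<close>. If \<open>c = 0\<close>, sending all new elements to
  one element of \<open>A\<close> reduces the coincidence to one inside \<open>A\<close>. If \<open>c \<ge> 2\<close>, comparing total absolute
  weights forces both tuples to avoid \<open>A\<close>, whence \<open>n = 0 = a\<^sub>1 + \<dots> + a\<^sub>h\<close>, and constant tuples over \<open>A\<close>
  represent \<open>n\<close>. If \<open>c = 1\<close>, view the first tuple as a map \<open>P\<close> from indices to indices (new elements)
  or elements of \<open>A\<close>; a retraction \<open>\<phi>\<close> onto \<open>A\<close> that is constant along the orbits of \<open>P\<close> turns the
  second tuple into a representation of \<open>n\<close> in \<open>A\<close>. When the coefficients have both signs, \<open>x\<close> can be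
  shifted by a large multiple of a positive kernel vector, so all new elements may be taken large.
\<close>

section \<open>Representations and uniqueness without equivalence classes\<close>

definition represents :: "'i set \<Rightarrow> ('i \<Rightarrow> int) \<Rightarrow> int set \<Rightarrow> int \<Rightarrow> bool" where
  "represents I a A n \<longleftrightarrow> (\<exists>x \<in> I \<rightarrow> A. (\<Sum>i\<in>I. a i * x i) = n)"

text \<open>Class weights are written as sums of indicators over all of \<open>I\<close>, so that
  weights and values of a tuple are both sums of \<open>a j * g (x j)\<close> for some
  \<open>g\<close> and obey the same identities.\<close>

definition separated :: "'i set \<Rightarrow> ('i \<Rightarrow> int) \<Rightarrow> int set \<Rightarrow> bool" where
  "separated I a A \<longleftrightarrow> (\<forall>x \<in> I \<rightarrow> A. \<forall>y \<in> I \<rightarrow> A.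
     (\<Sum>i\<in>I. a i * x i) = (\<Sum>i\<in>I. a i * y i) \<longrightarrow>
     (\<forall>\<xi>. (\<Sum>i\<in>I. a i * of_bool (x i = \<xi>)) = (\<Sum>i\<in>I. a i * of_bool (y i = \<xi>))))"

lemma separatedD:
  assumes "separated I a A" "x \<in> I \<rightarrow> A" "y \<in> I \<rightarrow> A"
    and "(\<Sum>i\<in>I. a i * x i) = (\<Sum>i\<in>I. a i * y i)"
  shows "(\<Sum>i\<in>I. a i * of_bool (x i = \<xi>)) = (\<Sum>i\<in>I. a i * of_bool (y i = \<xi>))"
  using assms unfolding separated_def by blast

lemma equiv_representations_altdef:
  "equiv_representations h a x y \<longleftrightarrow>
     (\<forall>\<xi>. (\<Sum>i\<in>{1..h}. a i * of_bool (x i = \<xi>)) = (\<Sum>i\<in>{1..h}. a i * of_bool (y i = \<xi>)))"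
proof -
  have "(\<Sum>i | i \<in> {1..h} \<and> z i = \<xi>. a i) = (\<Sum>i\<in>{1..h}. a i * of_bool (z i = \<xi>))"
    for z :: "nat \<Rightarrow> int" and \<xi>
    by (rule sum.mono_neutral_cong_left) auto
  then show ?thesis
    by (simp only: equiv_representations_def)
qed

text \<open>The quotient has exactly one class iff the set is nonempty and all its members are
  related. An infinite quotient has \<open>card\<close> 0, so the value \<infinity> is excluded as
  well.\<close>

lemma representation_function_eq_1_iff:
  "representation_function h a A n = 1 \<longleftrightarrow>
     representations h a A n \<noteq> {} \<and>
     (\<forall>x\<in>representations h a A n. \<forall>y\<in>representations h a A n. equiv_representations h a x y)"
    (is "_ \<longleftrightarrow> ?R \<noteq> {} \<and> ?E")
proof -
  let ?r = "representation_rel h a A n"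
  have eq: "equiv ?R ?r" by (rule equiv_representation_rel)
  have "representation_function h a A n = 1 \<longleftrightarrow> card (?R // ?r) = 1"
    by (auto simp: representation_function_def Let_def one_enat_def card_ge_0_finite)
  also have "\<dots> \<longleftrightarrow> (\<exists>C. ?R // ?r = {C})"
    by (simp add: card_1_singleton_iff)
  also have "\<dots> \<longleftrightarrow> ?R \<noteq> {} \<and> ?E"
  proof
    assume "\<exists>C. ?R // ?r = {C}"
    then obtain C where C: "?R // ?r = {C}" ..
    have "equiv_representations h a x y" if "x \<in> ?R" "y \<in> ?R" for x y
    proof -
      have "?r `` {x} = ?r `` {y}"
        using quotientI[OF that(1), of ?r] quotientI[OF that(2), of ?r] unfolding C by simp
      then have "(x, y) \<in> ?r"
        by (rule eq_equiv_class[OF _ eq that(2)])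
      then show ?thesis by (simp add: representation_rel_def)
    qed
    moreover have "?R \<noteq> {}" using C by (auto simp: quotient_def)
    ultimately show "?R \<noteq> {} \<and> ?E" by blast
  next
    assume R: "?R \<noteq> {} \<and> ?E"
    then obtain x where x: "x \<in> ?R" by blast
    have "?r `` {y} = ?R" if "y \<in> ?R" for y
      using R that by (auto simp: representation_rel_def)
    then have "?R // ?r = {?R}"
      using x by (auto simp: quotient_def)
    then show "\<exists>C. ?R // ?r = {C}" ..
  qed
  finally show ?thesis .
qed

text \<open>Restriction to \<open>{1..h}\<close> changes neither the value nor the weights of a
  function, so extensional tuples can be replaced by plain functions; quantifying over all
  \<open>n\<close> turns uniqueness of classes into one condition on pairs of tuples.\<close>

lemma unique_representation_basis_iff:
  "unique_representation_basis h a A \<longleftrightarrow>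
     (\<forall>n. represents {1..h} a A n) \<and> separated {1..h} a A"
proof -
  have restr: "(\<Sum>i\<in>{1..h}. a i * g (restrict x {1..h} i)) = (\<Sum>i\<in>{1..h}. a i * g (x i))"
    for g and x :: "nat \<Rightarrow> int" by (rule sum.cong) auto
  have mem: "restrict x {1..h} \<in> representations h a A n"
    if "x \<in> {1..h} \<rightarrow> A" "(\<Sum>i\<in>{1..h}. a i * x i) = n" for x n
    unfolding representations_def using that restr[of "\<lambda>z. z" x] by simp
  have rep: "representations h a A n \<noteq> {} \<longleftrightarrow> represents {1..h} a A n" for n
  proof
    assume "represents {1..h} a A n"
    then obtain x where "x \<in> {1..h} \<rightarrow> A" "(\<Sum>i\<in>{1..h}. a i * x i) = n"
      by (auto simp: represents_def)
    with mem show "representations h a A n \<noteq> {}" by blast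
  qed (force simp: represents_def representations_def PiE_def)
  have sep: "(\<forall>n. \<forall>x\<in>representations h a A n. \<forall>y\<in>representations h a A n.
      equiv_representations h a x y) \<longleftrightarrow> separated {1..h} a A" (is "?L \<longleftrightarrow> _")
  proof
    assume L: ?L
    show "separated {1..h} a A"
      unfolding separated_def
    proof (intro ballI impI)
      fix x y assume xy: "x \<in> {1..h} \<rightarrow> A" "y \<in> {1..h} \<rightarrow> A"
        "(\<Sum>i\<in>{1..h}. a i * x i) = (\<Sum>i\<in>{1..h}. a i * y i)"
      let ?n = "\<Sum>i\<in>{1..h}. a i * y i"
      have "restrict x {1..h} \<in> representations h a A ?n"
        and "restrict y {1..h} \<in> representations h a A ?n"
        using xy mem by blast+
      with L have "equiv_representations h a (restrict x {1..h}) (restrict y {1..h})"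
        by blast
      then show "\<forall>\<xi>. (\<Sum>i\<in>{1..h}. a i * of_bool (x i = \<xi>)) =
          (\<Sum>i\<in>{1..h}. a i * of_bool (y i = \<xi>))"
        unfolding equiv_representations_altdef restr[of "\<lambda>z. of_bool (z = _)"] .
    qed
  next
    assume "separated {1..h} a A"
    then show ?L
      unfolding separated_def equiv_representations_altdef representations_def PiE_def
      by (metis (mono_tags, lifting) Int_iff mem_Collect_eq)
  qed
  show ?thesis
    unfolding unique_representation_basis_def representation_function_eq_1_iff
    using rep sep by blast
qed

section \<open>Adjoining a generic solution to a separated set\<close>

text \<open>Indices whose orbit under \<open>P\<close> never leaves \<open>I\<close> are sent to \<open>b0\<close>.\<close>

lemma follow_to_terminal:
  fixes P :: "'i \<Rightarrow> 'i + 'b"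
  assumes P: "P \<in> I \<rightarrow> I <+> A" and "b0 \<in> A"
  obtains \<phi> where "\<And>b. b \<in> A \<Longrightarrow> \<phi> (Inr b) = b"
    and "\<And>s. s \<in> I <+> A \<Longrightarrow> \<phi> s \<in> A"
    and "\<And>i. i \<in> I \<Longrightarrow> \<phi> (P i) = \<phi> (Inl i)"
proof -
  \<comment> \<open>The new indices move along \<open>P\<close> and the elements of \<open>A\<close>
    are fixed points, so an orbit that meets \<open>A\<close> stays at its first element
    there.\<close>
  define step where "step s = (case s of Inl i \<Rightarrow> P i | Inr b \<Rightarrow> Inr b)" for s
  define reach where "reach s b \<longleftrightarrow> (\<exists>n. (step ^^ n) s = Inr b)" for s b
  define \<phi> where "\<phi> s = (if \<exists>b. reach s b then SOME b. reach s b else b0)" for s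
  have fix_Inr: "(step ^^ n) (Inr b) = Inr b" for n b
    by (induction n) (auto simp: step_def)
  have "step s \<in> I <+> A" if "s \<in> I <+> A" for s
    using that P unfolding step_def by (cases s) (auto dest: funcset_mem)
  then have inv: "(step ^^ n) s \<in> I <+> A" if "s \<in> I <+> A" for n s
    using that by (induction n) auto
  have "reach (step s) b \<longleftrightarrow> reach s b" for s b
  proof
    assume "reach (step s) b"
    then obtain n where "(step ^^ n) (step s) = Inr b" by (auto simp: reach_def)
    then have "(step ^^ Suc n) s = Inr b" by (simp add: funpow_swap1)
    then show "reach s b" unfolding reach_def by blast
  next
    assume "reach s b"
    then obtain n where "(step ^^ n) s = Inr b" by (auto simp: reach_def)
    then have "(step ^^ n) (step s) = Inr b"
      by (simp add: funpow_swap1[symmetric]) (simp add: step_def)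
    then show "reach (step s) b" unfolding reach_def by blast
  qed
  \<comment> \<open>Equal predicates give equal \<open>SOME\<close> choices, which makes
    \<open>\<phi>\<close> constant along orbits.\<close>
  then have "reach (step s) = reach s" for s by blast
  then have "\<phi> (step s) = \<phi> s" for s by (simp add: \<phi>_def)
  from this[of "Inl _"] have "\<phi> (P i) = \<phi> (Inl i)" for i by (simp add: step_def)
  moreover have "\<phi> (Inr b) = b" for b
  proof -
    have "reach (Inr b) = (\<lambda>b'. b' = b)" by (auto simp: reach_def fix_Inr)
    then show ?thesis by (simp add: \<phi>_def)
  qed
  moreover have "\<phi> s \<in> A" if "s \<in> I <+> A" for s
  proof (cases "\<exists>b. reach s b")
    case True
    then have "reach s (\<phi> s)" by (auto simp: \<phi>_def intro: someI)
    then obtain n where "(step ^^ n) s = Inr (\<phi> s)" by (auto simp: reach_def)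
    with inv[OF that, of n] show ?thesis by auto
  qed (use assms in \<open>simp add: \<phi>_def\<close>)
  ultimately show thesis using that by blast
qed

text \<open>On \<open>I <+> A\<close> every \<open>g\<close> is a combination of indicators of
  points; exchanging the sums groups the terms by the point that \<open>P\<close> or
  \<open>P'\<close> hits.\<close>

lemma sum_over_Plus:
  fixes a :: "'j \<Rightarrow> int"
  assumes fin: "finite I" "finite A" and P: "P \<in> J \<rightarrow> I <+> A" "P' \<in> J \<rightarrow> I <+> A"
  shows "(\<Sum>j\<in>J. a j * (g (P j) - g (P' j))) =
    (\<Sum>i\<in>I. (\<Sum>j\<in>J. a j * (of_bool (P j = Inl i) - of_bool (P' j = Inl i))) * g (Inl i)) +
    (\<Sum>b\<in>A. (\<Sum>j\<in>J. a j * (of_bool (P j = Inr b) - of_bool (P' j = Inr b))) * g (Inr b))"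
proof -
  have g: "g s = (\<Sum>i\<in>I. of_bool (s = Inl i) * g (Inl i)) +
      (\<Sum>b\<in>A. of_bool (s = Inr b) * g (Inr b))" if "s \<in> I <+> A" for s
    using that fin by (cases s) (auto simp: of_bool_def if_distrib[of "\<lambda>x. x * _"] cong: if_cong)
  have "(\<Sum>j\<in>J. a j * (g (P j) - g (P' j))) =
    (\<Sum>j\<in>J. (\<Sum>i\<in>I. a j * (of_bool (P j = Inl i) - of_bool (P' j = Inl i)) * g (Inl i)) +
      (\<Sum>b\<in>A. a j * (of_bool (P j = Inr b) - of_bool (P' j = Inr b)) * g (Inr b)))"
  proof (rule sum.cong)
    fix j assume "j \<in> J"
    then have "P j \<in> I <+> A" "P' j \<in> I <+> A" using P by auto
    then show "a j * (g (P j) - g (P' j)) =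
      (\<Sum>i\<in>I. a j * (of_bool (P j = Inl i) - of_bool (P' j = Inl i)) * g (Inl i)) +
      (\<Sum>b\<in>A. a j * (of_bool (P j = Inr b) - of_bool (P' j = Inr b)) * g (Inr b))"
      by (simp add: g[of "P j"] g[of "P' j"] algebra_simps sum_distrib_left sum_subtractf)
  qed simp
  then show ?thesis
    by (simp add: sum.distrib sum_distrib_right sum.swap[of _ J])
qed


text \<open>This is the greedy step. \<open>K\<close> bounds every coefficient and the constant term
  of the relation that arises from two formal tuples of equal value, so \<open>generic\<close>
  applies to each such relation.\<close>

lemma separated_extend:
  fixes a :: "'i \<Rightarrow> int"
  assumes fin: "finite I" "finite A" and nz: "\<forall>i\<in>I. a i \<noteq> 0" and b0: "b0 \<in> A"
    and sep: "separated I a A" and unrep: "\<not> represents I a A n"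
    and generic: "\<And>d e. \<lbrakk>\<forall>i\<in>I. \<bar>d i\<bar> \<le> K; \<bar>e\<bar> \<le> K; (\<Sum>i\<in>I. d i * x i) + e = 0\<rbrakk>
      \<Longrightarrow> \<exists>c. (\<forall>i\<in>I. d i = c * a i) \<and> e = - c * n"
    and K: "K = 2 * (\<Sum>i\<in>I. \<bar>a i\<bar>) * (1 + (\<Sum>b\<in>A. \<bar>b\<bar>))"
  shows "separated I a (A \<union> x ` I)"
proof -
  \<comment> \<open>\<open>Inl i\<close> is the formal new element with value \<open>x i\<close>; it may coincide with other elements.\<close>
  define val where "val = (\<lambda>s. case s of Inl i \<Rightarrow> x i | Inr b \<Rightarrow> b)"
  define D where
    "D P P' s = (\<Sum>j\<in>I. a j * (of_bool (P j = s) - of_bool (P' j = s)))"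
    for P P' :: "'i \<Rightarrow> 'i + int" and s
  define e where "e P P' = (\<Sum>b\<in>A. D P P' (Inr b) * b)" for P P'
  have expand: "(\<Sum>j\<in>I. a j * (g (P j) - g (P' j))) =
      (\<Sum>i\<in>I. D P P' (Inl i) * g (Inl i)) + (\<Sum>b\<in>A. D P P' (Inr b) * g (Inr b))"
    if "P \<in> I \<rightarrow> I <+> A" "P' \<in> I \<rightarrow> I <+> A" for P P' and g :: "'i + int \<Rightarrow> int"
    unfolding D_def using sum_over_Plus[OF fin that, of a g] .
  have bound: "\<bar>\<Sum>j\<in>I. a j * (g (P j) - g (P' j))\<bar> \<le> 2 * (\<Sum>i\<in>I. \<bar>a i\<bar>) * B"
    if "\<And>s. s \<in> I <+> A \<Longrightarrow> \<bar>g s\<bar> \<le> B" "P \<in> I \<rightarrow> I <+> A" "P' \<in> I \<rightarrow> I <+> A"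
    for g :: "'i + int \<Rightarrow> int" and P P' B
  proof -
    have "\<bar>\<Sum>j\<in>I. a j * (g (P j) - g (P' j))\<bar> \<le> (\<Sum>j\<in>I. \<bar>a j\<bar> * (2 * B))"
    proof (rule order_trans[OF sum_abs], rule sum_mono)
      fix j assume "j \<in> I"
      then have "\<bar>g (P j)\<bar> \<le> B" "\<bar>g (P' j)\<bar> \<le> B" using that by blast+
      then show "\<bar>a j * (g (P j) - g (P' j))\<bar> \<le> \<bar>a j\<bar> * (2 * B)"
        unfolding abs_mult by (intro mult_left_mono) auto
    qed
    then show ?thesis by (simp add: sum_distrib_right[symmetric])
  qed
  have gen: "\<exists>c. (\<forall>i\<in>I. D P P' (Inl i) = c * a i) \<and> e P P' = - c * n"
    if P: "P \<in> I \<rightarrow> I <+> A" "P' \<in> I \<rightarrow> I <+> A"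
      and eq: "(\<Sum>j\<in>I. a j * val (P j)) = (\<Sum>j\<in>I. a j * val (P' j))" for P P'
  proof (rule generic)
    let ?S = "\<Sum>b\<in>A. \<bar>b\<bar>" and ?M = "\<Sum>i\<in>I. \<bar>a i\<bar>"
    have nn: "?S \<ge> 0" "?M \<ge> 0" by (simp_all add: sum_nonneg)
    show "\<forall>i\<in>I. \<bar>D P P' (Inl i)\<bar> \<le> K"
      unfolding D_def K using nn by (intro ballI bound[OF _ P, of "\<lambda>s. of_bool (s = Inl _)"]) auto
    have "e P P' = (\<Sum>j\<in>I. a j * (case_sum (\<lambda>_. 0) id (P j) - case_sum (\<lambda>_. 0) id (P' j)))"
      using expand[OF P, of "case_sum (\<lambda>_. 0) id"] by (simp add: e_def)
    also have "\<bar>\<dots>\<bar> \<le> K"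
      unfolding K
    proof (rule bound[OF _ P])
      fix s assume "s \<in> I <+> A"
      then show "\<bar>case_sum (\<lambda>_. 0) id s\<bar> \<le> 1 + ?S"
        using nn member_le_sum[of _ A abs] fin by fastforce
    qed
    finally show "\<bar>e P P'\<bar> \<le> K" .
    show "(\<Sum>i\<in>I. D P P' (Inl i) * x i) + e P P' = 0"
      using expand[OF P, of val] eq
      by (simp add: e_def val_def right_diff_distrib sum_subtractf)
  qed
  have main: "(\<Sum>j\<in>I. a j * of_bool (val (P j) = \<xi>)) = (\<Sum>j\<in>I. a j * of_bool (val (P' j) = \<xi>))"
    if P: "P \<in> I \<rightarrow> I <+> A" "P' \<in> I \<rightarrow> I <+> A"
      and D: "\<And>i. i \<in> I \<Longrightarrow> D P P' (Inl i) = c * a i" and e: "e P P' = - c * n"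
      and c: "c \<ge> 0" for P P' \<xi> c
  proof -
    consider "c = 0" | "c = 1" | "c \<ge> 2" using c by linarith
    then show ?thesis
    proof cases
      case 1
      define \<phi> where "\<phi> = case_sum (\<lambda>_::'i. b0) id"
      have mem: "(\<lambda>j. \<phi> (P j)) \<in> I \<rightarrow> A" "(\<lambda>j. \<phi> (P' j)) \<in> I \<rightarrow> A"
        using P b0 by (auto simp: \<phi>_def dest!: funcset_mem)
      have "(\<Sum>j\<in>I. a j * \<phi> (P j)) = (\<Sum>j\<in>I. a j * \<phi> (P' j))"
        using expand[OF P, of \<phi>] D e 1
        by (simp add: e_def \<phi>_def right_diff_distrib sum_subtractf)
      then have eqv: "(\<Sum>j\<in>I. a j * of_bool (\<phi> (P j) = \<eta>)) = (\<Sum>j\<in>I. a j * of_bool (\<phi> (P' j) = \<eta>))" for \<eta>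
        using separatedD[OF sep mem] by blast
      \<comment> \<open>In the expansion of the indicator of \<open>\<phi> s = \<eta>\<close> the
        new elements have coefficient 0, so \<open>D P P' (Inr \<eta>)\<close> is all that
        remains.\<close>
      have "D P P' (Inr \<eta>) = 0" if "\<eta> \<in> A" for \<eta>
        using expand[OF P, of "\<lambda>s. of_bool (\<phi> s = \<eta>)"] D 1 eqv[of \<eta>] that fin
        by (simp add: \<phi>_def right_diff_distrib sum_subtractf of_bool_def
            if_distrib[of "\<lambda>x. _ * x"] cong: if_cong)
      then show ?thesis
        using expand[OF P, of "\<lambda>s. of_bool (val s = \<xi>)"] D 1
        by (simp add: right_diff_distrib sum_subtractf)
    next
      case 2
      obtain \<phi> where \<phi>: "\<And>b. b \<in> A \<Longrightarrow> \<phi> (Inr b) = b" "\<And>s. s \<in> I <+> A \<Longrightarrow> \<phi> s \<in> A"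
        "\<And>i. i \<in> I \<Longrightarrow> \<phi> (P i) = \<phi> (Inl i)"
        using follow_to_terminal[OF P(1) b0] by blast
      \<comment> \<open>As \<open>\<phi> (P i) = \<phi> (Inl i)\<close>, the contribution of
        \<open>P\<close> cancels that of the new elements on the right, which leaves the value
        \<open>n\<close> for the images of \<open>P'\<close>.\<close>
      have "(\<Sum>j\<in>I. a j * (\<phi> (P j) - \<phi> (P' j))) = (\<Sum>i\<in>I. a i * \<phi> (Inl i)) - n"
        using expand[OF P, of \<phi>] D e 2 \<phi>(1) by (simp add: e_def)
      then have "(\<Sum>j\<in>I. a j * \<phi> (P' j)) = n"
        using \<phi>(3) by (simp add: right_diff_distrib sum_subtractf)
      moreover have "(\<lambda>j. \<phi> (P' j)) \<in> I \<rightarrow> A"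
        using P \<phi>(2) by blast
      ultimately have "represents I a A n"
        unfolding represents_def by (intro bexI[of _ "\<lambda>j. \<phi> (P' j)"])
      with unrep show ?thesis ..
    next
      case 3
      \<comment> \<open>With signs as test function the expansion equals \<open>c\<close> times the
        total absolute weight, whereas each summand is at most \<open>2 * \<bar>a j\<bar>\<close>.
        For \<open>c \<ge> 2\<close> every summand is extremal, so \<open>g\<close> vanishes at no
        entry of either tuple.\<close>
      define g where "g = case_sum (\<lambda>i. sgn (a i)) (\<lambda>_::int. 0)"
      have g1: "\<bar>g s\<bar> \<le> 1" for s by (cases s) (auto simp: g_def sgn_if)
      have le: "a j * (g (P j) - g (P' j)) \<le> 2 * \<bar>a j\<bar>" for j
      proof -
        have "\<bar>a j * (g (P j) - g (P' j))\<bar> \<le> \<bar>a j\<bar> * 2"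
          unfolding abs_mult using g1[of "P j"] g1[of "P' j"] by (intro mult_left_mono) auto
        then show ?thesis by linarith
      qed
      have "(\<Sum>j\<in>I. a j * (g (P j) - g (P' j))) = c * (\<Sum>i\<in>I. \<bar>a i\<bar>)"
        using expand[OF P, of g] D
        by (simp add: g_def sum_distrib_left mult.assoc abs_sgn mult_ac)
      also have "\<dots> \<ge> 2 * (\<Sum>i\<in>I. \<bar>a i\<bar>)"
        using 3 by (intro mult_right_mono sum_nonneg) auto
      finally have "(\<Sum>j\<in>I. 2 * \<bar>a j\<bar> - a j * (g (P j) - g (P' j))) \<le> 0"
        by (simp add: sum_subtractf sum_distrib_left)
      then have "(\<Sum>j\<in>I. 2 * \<bar>a j\<bar> - a j * (g (P j) - g (P' j))) = 0"
        using le by (intro antisym sum_nonneg) auto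
      then have tight: "a j * (g (P j) - g (P' j)) = 2 * \<bar>a j\<bar>" if "j \<in> I" for j
        using that le fin(1) by (subst (asm) sum_nonneg_eq_0_iff) auto
      have nz_g: "g (P j) \<noteq> 0 \<and> g (P' j) \<noteq> 0" if "j \<in> I" for j
      proof -
        have "\<bar>a j\<bar> * \<bar>g (P j) - g (P' j)\<bar> = \<bar>a j\<bar> * 2"
          using tight[OF that] by (simp add: abs_mult[symmetric])
        then have "\<bar>g (P j) - g (P' j)\<bar> = 2"
          using nz that by simp
        then show ?thesis using g1[of "P j"] g1[of "P' j"] by auto
      qed
      have "P j \<noteq> Inr b \<and> P' j \<noteq> Inr b" if "j \<in> I" for j b
        using nz_g[OF that] by (auto simp: g_def)
      then have D0: "D P P' (Inr b) = 0" for b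
        unfolding D_def by (intro sum.neutral) simp
      then have "n = 0" using e 3 by (simp add: e_def)
      \<comment> \<open>The constant test function 1 makes the left side of the expansion 0 and the
        right side \<open>c\<close> times the sum of the coefficients.\<close>
      moreover have "(\<Sum>i\<in>I. a i) = 0"
        using expand[OF P, of "\<lambda>_. 1"] D D0 3 by (simp add: sum_distrib_left[symmetric])
      ultimately have "represents I a A n"
        using b0 unfolding represents_def
        by (intro bexI[of _ "\<lambda>_. b0"]) (auto simp: sum_distrib_right[symmetric])
      with unrep show ?thesis ..
    qed
  qed
  \<comment> \<open>\<open>val\<close> may fail to be injective, so the formal tuple is a choice;
    the conclusion of \<open>main\<close> depends on it only through \<open>val\<close>.\<close>
  have lift: "\<exists>P \<in> I \<rightarrow> I <+> A. \<forall>j\<in>I. val (P j) = y j" if y: "y \<in> I \<rightarrow> A \<union> x ` I" for y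
  proof -
    have "\<exists>s. s \<in> I <+> A \<and> val s = y j" if "j \<in> I" for j
    proof -
      from y that consider "y j \<in> A" | i where "i \<in> I" "y j = x i" by blast
      then show ?thesis
      proof cases
        case 1
        then show ?thesis by (intro exI[of _ "Inr (y j)"]) (auto simp: val_def)
      next
        case (2 i)
        then show ?thesis by (intro exI[of _ "Inl i"]) (auto simp: val_def)
      qed
    qed
    then obtain P where "\<forall>j\<in>I. P j \<in> I <+> A \<and> val (P j) = y j" by metis
    then show ?thesis by blast
  qed
  show ?thesis
    unfolding separated_def
  proof (intro ballI impI allI)
    fix y z \<xi>
    assume y: "y \<in> I \<rightarrow> A \<union> x ` I" and z: "z \<in> I \<rightarrow> A \<union> x ` I"
      and eq: "(\<Sum>i\<in>I. a i * y i) = (\<Sum>i\<in>I. a i * z i)"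
    from lift[OF y] obtain P where P_in: "P \<in> I \<rightarrow> I <+> A"
      and P_val: "\<forall>j\<in>I. val (P j) = y j" ..
    from lift[OF z] obtain P' where P'_in: "P' \<in> I \<rightarrow> I <+> A"
      and P'_val: "\<forall>j\<in>I. val (P' j) = z j" ..
    note P = P_in P'_in and val = P_val P'_val
    have eq': "(\<Sum>j\<in>I. a j * val (P j)) = (\<Sum>j\<in>I. a j * val (P' j))"
      using eq val by simp
    obtain c where c: "\<forall>i\<in>I. D P P' (Inl i) = c * a i" "e P P' = - c * n"
      using gen[OF P eq'] by blast
    have "(\<Sum>j\<in>I. a j * of_bool (val (P j) = \<xi>)) = (\<Sum>j\<in>I. a j * of_bool (val (P' j) = \<xi>))"
    proof (cases "c \<ge> 0")
      case True
      then show ?thesis using main[OF P _ c(2)] c(1) by blast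
    next
      case False
      \<comment> \<open>Exchanging the two tuples replaces \<open>c\<close> by
        \<open>- c\<close>.\<close>
      have swap: "D P' P s = - D P P' s" for s
        unfolding D_def by (simp add: sum_negf[symmetric] algebra_simps)
      have "(\<Sum>j\<in>I. a j * of_bool (val (P' j) = \<xi>)) = (\<Sum>j\<in>I. a j * of_bool (val (P j) = \<xi>))"
        using c False by (intro main[OF P(2,1), of "- c"]) (auto simp: swap e_def sum_negf)
      then show ?thesis ..
    qed
    then show "(\<Sum>i\<in>I. a i * of_bool (y i = \<xi>)) = (\<Sum>i\<in>I. a i * of_bool (z i = \<xi>))"
      using val by simp
  qed
qed

section \<open>Base \<open>T\<close> digits and generic solutions\<close>

text \<open>Modulo \<open>T\<close> the sum is \<open>f 0\<close>, which is smaller than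
  \<open>T\<close> in absolute value and therefore 0; dividing by \<open>T\<close> shifts the
  remaining digits down.\<close>

lemma digits_zero:
  fixes T :: int
  assumes "\<forall>i\<le>m. \<bar>f i\<bar> < T" and "(\<Sum>i\<le>m. f i * T ^ i) = 0" and "i \<le> m"
  shows "f i = 0"
  using assms
proof (induction m arbitrary: f i)
  case (Suc m)
  have eq: "f 0 + T * (\<Sum>i\<le>m. f (Suc i) * T ^ i) = 0"
    using Suc.prems(2) by (simp add: sum.atMost_Suc_shift sum_distrib_left mult_ac del: sum.atMost_Suc)
  then have "T dvd f 0" by (metis add_eq_0_iff2 dvd_minus_iff dvd_triv_left)
  moreover have "\<bar>f 0\<bar> < T" using Suc.prems(1) by blast
  ultimately have f0: "f 0 = 0" using zdvd_not_zless[of "\<bar>f 0\<bar>" T] by fastforce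
  have "T > 0" using \<open>\<bar>f 0\<bar> < T\<close> by linarith
  with eq f0 have "(\<Sum>i\<le>m. f (Suc i) * T ^ i) = 0" by simp
  with Suc.IH[of "\<lambda>i. f (Suc i)"] Suc.prems(1) have "f (Suc j) = 0" if "j \<le> m" for j
    using that by auto
  with f0 Suc.prems(3) show ?case by (cases i) auto
qed simp


text \<open>With Bezout coefficients \<open>u\<close>, every \<open>x = n u + t - (a \<bullet> t) u\<close> solves \<open>a \<bullet> x = n\<close>, and
  \<open>d \<bullet> x = n c + (d - c a) \<bullet> t\<close> with \<open>c = d \<bullet> u\<close>. The choice \<open>t\<^sub>i = T\<^sup>i + T\<^bsup>h+1\<^esup> k\<^sub>i\<close> makes the vanishing
  of \<open>d \<bullet> x + e\<close> a statement about digits in base \<open>T\<close>.\<close>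

lemma generic_solution:
  fixes a u k :: "nat \<Rightarrow> int"
  assumes u: "(\<Sum>i\<in>{1..h}. a i * u i) = 1" and k: "(\<Sum>i\<in>{1..h}. a i * k i) = 0" and "K \<ge> 0"
  obtains x where "(\<Sum>i\<in>{1..h}. a i * x i) = n"
    and "\<And>d e. \<lbrakk>\<forall>i\<in>{1..h}. \<bar>d i\<bar> \<le> K; \<bar>e\<bar> \<le> K; (\<Sum>i\<in>{1..h}. d i * x i) + e = 0\<rbrakk>
      \<Longrightarrow> \<exists>c. (\<forall>i\<in>{1..h}. d i = c * a i) \<and> e = - c * n"
    and "\<forall>i\<in>{1..h}. k i \<ge> 1 \<Longrightarrow> \<forall>i\<in>{1..h}. x i \<ge> N"
proof -
  let ?I = "{1..h}"
  define U where "U = (\<Sum>i\<in>?I. \<bar>u i\<bar>)"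
  define M where "M = (\<Sum>i\<in>?I. \<bar>a i\<bar>)"
  define L where "L = (\<Sum>i\<in>?I. \<bar>k i\<bar>)"
  \<comment> \<open>\<open>F\<close> bounds the coefficients \<open>d i - c * a i\<close>, as
    \<open>\<bar>c\<bar> \<le> K * U\<close>. The terms of \<open>T\<close> up to
    \<open>F * L\<close> dominate all digits below; the last three serve the lower bound
    \<open>N\<close>.\<close>
  define F where "F = K + K * U * M"
  define T where "T = 1 + F + K + \<bar>n\<bar> * (K * U) + F * L + U * M + \<bar>n\<bar> * U + \<bar>N\<bar>"
  define t where "t i = T ^ i + T ^ Suc h * k i" for i
  define S where "S = (\<Sum>i\<in>?I. a i * T ^ i)"
  define x where "x i = n * u i + t i - S * u i" for i
  have nn: "U \<ge> 0" "M \<ge> 0" "L \<ge> 0" by (simp_all add: U_def M_def L_def sum_nonneg)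
  have nnF: "F \<ge> 0" using nn \<open>K \<ge> 0\<close> by (simp add: F_def)
  have prods: "\<bar>n\<bar> * (K * U) \<ge> 0" "F * L \<ge> 0" "U * M \<ge> 0" "\<bar>n\<bar> * U \<ge> 0"
    using nn nnF \<open>K \<ge> 0\<close> by simp_all
  have T1: "T \<ge> 1" using prods nnF \<open>K \<ge> 0\<close> by (simp add: T_def)
  have le_sum: "\<bar>g i\<bar> \<le> (\<Sum>i\<in>?I. \<bar>g i\<bar>)" if "i \<in> ?I" for g :: "nat \<Rightarrow> int" and i
    using that member_le_sum[of i ?I "\<lambda>i. \<bar>g i\<bar>"] by simp
  have dot_bound: "\<bar>\<Sum>i\<in>?I. d i * g i\<bar> \<le> B * (\<Sum>i\<in>?I. \<bar>g i\<bar>)"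
    if "\<forall>i\<in>?I. \<bar>d i\<bar> \<le> B" for d g :: "nat \<Rightarrow> int" and B
    unfolding sum_distrib_left
    by (rule order_trans[OF sum_abs], rule sum_mono) (use that in \<open>auto simp: abs_mult intro!: mult_right_mono\<close>)
  have at: "(\<Sum>i\<in>?I. a i * t i) = S"
  proof -
    have "(\<Sum>i\<in>?I. a i * t i) = S + T ^ Suc h * (\<Sum>i\<in>?I. a i * k i)"
      unfolding t_def S_def sum_distrib_left sum.distrib[symmetric]
      by (rule sum.cong) (auto simp: algebra_simps)
    then show ?thesis using k by simp
  qed
  have dx: "(\<Sum>i\<in>?I. d i * x i) =
      n * (\<Sum>i\<in>?I. d i * u i) + (\<Sum>i\<in>?I. d i * t i) - S * (\<Sum>i\<in>?I. d i * u i)" for d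
    unfolding x_def sum_distrib_left sum.distrib[symmetric] sum_subtractf[symmetric]
    by (rule sum.cong) (auto simp: algebra_simps)
  have "(\<Sum>i\<in>?I. a i * x i) = n"
    unfolding dx u at by simp
  moreover have "\<exists>c. (\<forall>i\<in>?I. d i = c * a i) \<and> e = - c * n"
    if d: "\<forall>i\<in>?I. \<bar>d i\<bar> \<le> K" and e: "\<bar>e\<bar> \<le> K" and eq: "(\<Sum>i\<in>?I. d i * x i) + e = 0" for d e
  proof -
    define c where "c = (\<Sum>i\<in>?I. d i * u i)"
    define f where "f i = d i - c * a i" for i
    \<comment> \<open>Digit 0 holds the constant part, digits 1 to \<open>h\<close> the deviations
      \<open>f i\<close> from a multiple of \<open>a\<close>, and digit \<open>h + 1\<close> what
      the shift by \<open>k\<close> contributes.\<close>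
    define G where "G i = (if i = 0 then n * c + e else if i \<le> h then f i else \<Sum>i\<in>?I. f i * k i)" for i
    have cb: "\<bar>c\<bar> \<le> K * U" unfolding c_def U_def using dot_bound[OF d] .
    have fb: "\<forall>i\<in>?I. \<bar>f i\<bar> \<le> F"
    proof
      fix i assume i: "i \<in> ?I"
      have "\<bar>c * a i\<bar> \<le> (K * U) * M"
        unfolding abs_mult using cb le_sum[OF i, of a] nn \<open>K \<ge> 0\<close>
        by (intro mult_mono) (auto simp: M_def)
      then show "\<bar>f i\<bar> \<le> F" using d i unfolding f_def F_def by fastforce
    qed
    have "\<bar>n * c\<bar> \<le> \<bar>n\<bar> * (K * U)"
      unfolding abs_mult using cb by (intro mult_left_mono) auto
    then have G0: "\<bar>n * c + e\<bar> < T"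
      using e prods nnF unfolding T_def by linarith
    have GL: "\<bar>\<Sum>i\<in>?I. f i * k i\<bar> < T"
      using dot_bound[OF fb, of k] prods nnF \<open>K \<ge> 0\<close> unfolding T_def L_def[symmetric] by linarith
    have "F < T" using prods \<open>K \<ge> 0\<close> unfolding T_def by linarith
    then have "\<bar>f i\<bar> < T" if "i \<in> ?I" for i using fb that by fastforce
    then have bounds: "\<forall>i\<le>Suc h. \<bar>G i\<bar> < T"
      using G0 GL by (simp add: G_def)
    have split: "{..Suc h} = insert 0 (insert (Suc h) ?I)" by auto
    have "(\<Sum>i\<le>Suc h. G i * T ^ i) =
        (n * c + e) + ((\<Sum>i\<in>?I. f i * k i) * T ^ Suc h + (\<Sum>i\<in>?I. f i * T ^ i))"
      unfolding split by (subst sum.insert, simp, simp, subst sum.insert) (auto simp: G_def)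
    also have "(\<Sum>i\<in>?I. f i * k i) * T ^ Suc h + (\<Sum>i\<in>?I. f i * T ^ i) = (\<Sum>i\<in>?I. f i * t i)"
      unfolding t_def sum_distrib_right sum.distrib[symmetric]
      by (rule sum.cong) (auto simp: algebra_simps)
    also have "(\<Sum>i\<in>?I. f i * t i) = (\<Sum>i\<in>?I. d i * t i) - c * S"
      unfolding at[symmetric] f_def sum_distrib_left sum_subtractf[symmetric]
      by (rule sum.cong) (auto simp: algebra_simps)
    finally have "(\<Sum>i\<le>Suc h. G i * T ^ i) = 0"
      using eq unfolding dx c_def[symmetric] by (simp add: algebra_simps)
    from digits_zero[OF bounds this] have G: "G i = 0" if "i \<le> Suc h" for i
      using that by blast
    have "d i = c * a i" if "i \<in> ?I" for i
      using G[of i] that by (simp add: G_def f_def)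
    moreover have "e = - c * n" using G[of 0] by (simp add: G_def algebra_simps)
    ultimately show ?thesis by blast
  qed
  moreover have "\<forall>i\<in>?I. x i \<ge> N" if k1: "\<forall>i\<in>?I. k i \<ge> 1"
  proof
    fix i assume i: "i \<in> ?I"
    have Th: "T ^ h \<ge> 1" using T1 by simp
    have ui: "\<bar>u i\<bar> \<le> U" using le_sum[OF i] by (simp add: U_def)
    have "\<bar>S\<bar> \<le> T ^ h * M"
    proof -
      have "\<forall>j\<in>?I. \<bar>T ^ j\<bar> \<le> T ^ h" using T1 by (auto intro: power_increasing)
      from dot_bound[OF this, of a] show ?thesis by (simp add: S_def M_def mult.commute)
    qed
    then have "\<bar>S * u i\<bar> \<le> (T ^ h * M) * U"
      unfolding abs_mult using ui nn Th by (intro mult_mono) auto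
    moreover have "\<bar>n * u i\<bar> \<le> \<bar>n\<bar> * U"
      unfolding abs_mult using ui by (intro mult_left_mono) auto
    moreover have "T ^ Suc h * k i \<ge> T ^ Suc h * 1"
      using k1 i T1 by (intro mult_left_mono) auto
    \<comment> \<open>The part with \<open>U * M\<close> absorbs \<open>S * u i\<close>; the rest
      absorbs \<open>n * u i\<close> and leaves at least \<open>\<bar>N\<bar>\<close>.\<close>
    moreover have "T ^ Suc h \<ge> T ^ h * (U * M + (\<bar>n\<bar> * U + \<bar>N\<bar>))"
    proof -
      have "U * M + (\<bar>n\<bar> * U + \<bar>N\<bar>) \<le> T"
        using prods nnF \<open>K \<ge> 0\<close> unfolding T_def by linarith
      then show ?thesis using Th by (simp add: mult.commute mult_right_mono)
    qed
    moreover have "T ^ h * (\<bar>n\<bar> * U + \<bar>N\<bar>) \<ge> 1 * (\<bar>n\<bar> * U + \<bar>N\<bar>)"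
      using Th prods by (intro mult_right_mono) auto
    moreover have "T ^ i \<ge> 0" using T1 by simp
    ultimately show "x i \<ge> N"
      unfolding x_def t_def by (simp add: algebra_simps)
  qed
  ultimately show thesis by (rule that)
qed

section \<open>Greedy construction along an enumeration of the integers\<close>

lemma bezout_Gcd:
  fixes a :: "'i \<Rightarrow> int"
  assumes "finite I"
  shows "\<exists>u. (\<Sum>i\<in>I. a i * u i) = Gcd (a ` I)"
  using assms
proof (induction I)
  case (insert j I)
  then obtain u where u: "(\<Sum>i\<in>I. a i * u i) = Gcd (a ` I)" by blast
  obtain p q where pq: "p * a j + q * Gcd (a ` I) = gcd (a j) (Gcd (a ` I))"
    using bezout_int by blast
  have "(\<Sum>i\<in>insert j I. a i * (if i = j then p else q * u i)) = p * a j + (\<Sum>i\<in>I. q * (a i * u i))"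
    using insert.hyps by (auto simp: mult_ac intro!: sum.cong)
  also have "\<dots> = Gcd (a ` insert j I)"
    using u pq by (simp add: sum_distrib_left[symmetric])
  finally show ?case by (rule exI[of _ "\<lambda>i. if i = j then p else q * u i"])
qed simp

lemma represents_mono: "represents I a A n \<Longrightarrow> A \<subseteq> B \<Longrightarrow> represents I a B n"
  unfolding represents_def by blast

lemma separated_singleton: "separated I a {b}"
  unfolding separated_def by (auto simp: Pi_iff intro!: sum.cong)

text \<open>A tuple has finitely many entries, so any two tuples over the union already lie over one
  member of the chain.\<close>

lemma separated_Union_chain:
  assumes fin: "finite I" and mono: "\<And>m. A m \<subseteq> A (Suc m)" and sep: "\<And>m. separated I a (A m)"
  shows "separated I a (\<Union>m. A m)"
proof -
  have le: "A m \<subseteq> A m'" if "m \<le> m'" for m m'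
    using lift_Suc_mono_le[of A, OF mono that] .
  have stage: "\<exists>m. x \<in> I \<rightarrow> A m" if "x \<in> I \<rightarrow> (\<Union>m. A m)" for x :: "'a \<Rightarrow> int"
  proof -
    have "\<forall>i\<in>I. \<exists>m. x i \<in> A m" using that by blast
    then obtain s where s: "\<forall>i\<in>I. x i \<in> A (s i)" by metis
    have "x i \<in> A (Max (s ` I))" if "i \<in> I" for i
      using le[of "s i" "Max (s ` I)"] s that fin by auto
    then show ?thesis by blast
  qed
  show ?thesis
    unfolding separated_def
  proof (intro ballI impI allI)
    fix x y \<xi> assume x: "x \<in> I \<rightarrow> (\<Union>m. A m)" and y: "y \<in> I \<rightarrow> (\<Union>m. A m)"
      and eq: "(\<Sum>i\<in>I. a i * x i) = (\<Sum>i\<in>I. a i * y i)"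
    from stage[OF x] obtain m where "x \<in> I \<rightarrow> A m" ..
    moreover from stage[OF y] obtain m' where "y \<in> I \<rightarrow> A m'" ..
    ultimately have "x \<in> I \<rightarrow> A (max m m')" "y \<in> I \<rightarrow> A (max m m')"
      using le[of m "max m m'"] le[of m' "max m m'"] by auto
    then show "(\<Sum>i\<in>I. a i * of_bool (x i = \<xi>)) = (\<Sum>i\<in>I. a i * of_bool (y i = \<xi>))"
      using eq by (rule separatedD[OF sep])
  qed
qed

text \<open>Both existence claims come from one construction: a positive kernel vector keeps all new
  elements in \<open>{N..}\<close>, and with \<open>B = UNIV\<close> the zero vector will do for
  \<open>k\<close>.\<close>

lemma exists_basis:
  assumes nz: "\<forall>i\<in>{1..h}. a i \<noteq> 0" and prim: "primitive_form h a"
    and k: "(\<Sum>i\<in>{1..h}. a i * k i) = 0"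
    and B: "(\<forall>i\<in>{1..h}. k i \<ge> 1) \<and> B = {N..} \<or> B = UNIV"
  shows "\<exists>A. unique_representation_basis h a A \<and> A \<subseteq> B"
proof -
  let ?I = "{1..h}"
  obtain u where u: "(\<Sum>i\<in>?I. a i * u i) = 1"
    using bezout_Gcd[of ?I a] prim by (auto simp: primitive_form_def)
  \<comment> \<open>Nonemptiness supplies the element \<open>b0\<close> that the extension step
    uses.\<close>
  define good where "good A \<longleftrightarrow> finite A \<and> A \<noteq> {} \<and> A \<subseteq> B \<and> separated ?I a A" for A
  have step: "\<exists>A'. good A' \<and> A \<subseteq> A' \<and> represents ?I a A' n" if A: "good A" for A n
  proof (cases "represents ?I a A n")
    case False
    obtain b0 where b0: "b0 \<in> A" using A by (auto simp: good_def)
    define K where "K = 2 * (\<Sum>i\<in>?I. \<bar>a i\<bar>) * (1 + (\<Sum>b\<in>A. \<bar>b\<bar>))"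
    have "K \<ge> 0" unfolding K_def by (intro mult_nonneg_nonneg add_nonneg_nonneg sum_nonneg) auto
    then obtain x where x: "(\<Sum>i\<in>?I. a i * x i) = n"
      and gen: "\<And>d e. \<lbrakk>\<forall>i\<in>?I. \<bar>d i\<bar> \<le> K; \<bar>e\<bar> \<le> K; (\<Sum>i\<in>?I. d i * x i) + e = 0\<rbrakk>
        \<Longrightarrow> \<exists>c. (\<forall>i\<in>?I. d i = c * a i) \<and> e = - c * n"
      and pos: "\<forall>i\<in>?I. k i \<ge> 1 \<Longrightarrow> \<forall>i\<in>?I. x i \<ge> N"
      using generic_solution[OF u k, of K n N] by blast
    have "separated ?I a (A \<union> x ` ?I)"
      using A by (intro separated_extend[OF _ _ nz b0 _ False gen K_def]) (auto simp: good_def)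
    moreover have "x ` ?I \<subseteq> B" using B pos by auto
    ultimately have "good (A \<union> x ` ?I)" using A by (auto simp: good_def)
    moreover have "represents ?I a (A \<union> x ` ?I) n"
      using x unfolding represents_def by blast
    ultimately show ?thesis by blast
  qed (use A in blast)
  \<comment> \<open>Stage \<open>m\<close> of the chain takes care of the integer
    \<open>z m\<close>; if it is represented already, the set stays as it is.\<close>
  obtain z :: "nat \<Rightarrow> int" where z: "surj z"
    using surj_int_decode by blast
  obtain b where b: "b \<in> B" using B by auto
  have "\<exists>A. \<forall>m. good (A m) \<and> (A m \<subseteq> A (Suc m) \<and> represents ?I a (A (Suc m)) (z m))"
  proof (rule dependent_nat_choice)
    show "\<exists>A. good A" using b separated_singleton[of ?I a b] by (auto simp: good_def intro!: exI[of _ "{b}"])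
  qed (use step in blast)
  then obtain A where A: "\<And>m. good (A m)" "\<And>m. A m \<subseteq> A (Suc m)"
    "\<And>m. represents ?I a (A (Suc m)) (z m)" by blast
  have "represents ?I a (\<Union>m. A m) n" for n
  proof -
    obtain m where "n = z m" using z by (rule surjE)
    with A(3)[of m] show ?thesis by (auto intro: represents_mono)
  qed
  moreover have "separated ?I a (\<Union>m. A m)"
    using A by (intro separated_Union_chain) (auto simp: good_def)
  moreover have "(\<Union>m. A m) \<subseteq> B" using A(1) by (auto simp: good_def)
  ultimately show ?thesis unfolding unique_representation_basis_iff by blast
qed

section \<open>Signs of the coefficients and the theorem\<close>

text \<open>Let \<open>P\<close> be the sum of the positive coefficients and \<open>Q\<close> that
  of the absolute values of the negative ones. Entry \<open>Q\<close> at the former and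
  \<open>P\<close> at the latter gives \<open>Q * P - P * Q = 0\<close>.\<close>

lemma positive_kernel_vector:
  fixes a :: "'i \<Rightarrow> int"
  assumes "finite I" "p \<in> I" "a p > 0" "q \<in> I" "a q < 0"
  shows "\<exists>k. (\<Sum>i\<in>I. a i * k i) = 0 \<and> (\<forall>i\<in>I. k i \<ge> 1)"
proof -
  define P where "P = (\<Sum>i\<in>I. max (a i) 0)"
  define Q where "Q = (\<Sum>i\<in>I. max (- a i) 0)"
  have "P \<ge> a p" "Q \<ge> - a q"
    unfolding P_def Q_def
    using member_le_sum[of p I "\<lambda>i. max (a i) 0"] member_le_sum[of q I "\<lambda>i. max (- a i) 0"] assms
    by auto
  then have "P \<ge> 1" "Q \<ge> 1" using assms by auto
  moreover have "(\<Sum>i\<in>I. a i * (if a i > 0 then Q else P)) = 0"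
  proof -
    have "(\<Sum>i\<in>I. a i * (if a i > 0 then Q else P)) =
        (\<Sum>i\<in>I. Q * max (a i) 0 - P * max (- a i) 0)"
      by (rule sum.cong) auto
    also have "\<dots> = Q * P - P * Q"
      unfolding sum_subtractf sum_distrib_left[symmetric] P_def[symmetric] Q_def[symmetric] ..
    finally show ?thesis by simp
  qed
  ultimately show ?thesis by (intro exI[of _ "\<lambda>i. if a i > 0 then Q else P"]) auto
qed

text \<open>The gcd of the coefficients divides every value of the form, in particular 1.\<close>

lemma primitive_if_represents_1:
  assumes "represents {1..h} a A 1"
  shows "primitive_form h a"
proof -
  obtain x where "(\<Sum>i\<in>{1..h}. a i * x i) = 1" using assms by (auto simp: represents_def)
  moreover have "Gcd (a ` {1..h}) dvd (\<Sum>i\<in>{1..h}. a i * x i)"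
    by (intro dvd_sum dvd_mult2 Gcd_dvd) auto
  ultimately show ?thesis by (simp add: primitive_form_def)
qed

theorem theorem2p1:
  fixes h :: nat and a :: "nat \<Rightarrow> int"
  assumes "h \<ge> 1"
    and "\<forall>i\<in>{1..h}. a i \<noteq> 0"
  shows "((\<exists>A. unique_representation_basis h a A) \<longleftrightarrow> primitive_form h a) \<and>
    ((primitive_form h a \<and> \<not> (\<forall>i\<in>{1..h}. \<forall>j\<in>{1..h}. sgn (a i) = sgn (a j))) \<longleftrightarrow>
     (\<forall>n. \<exists>A. unique_representation_basis h a A \<and> A \<subseteq> {n..}))"
proof -
  have prim: "primitive_form h a" if "unique_representation_basis h a A" for A
    using that primitive_if_represents_1[of h a A] by (simp only: unique_representation_basis_iff)
  have ex: "\<exists>A. unique_representation_basis h a A" if "primitive_form h a"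
    using exists_basis[OF assms(2) that, of "\<lambda>_. 0" UNIV] by auto
  have ex_pos: "\<exists>A. unique_representation_basis h a A \<and> A \<subseteq> {n..}"
    if "primitive_form h a" and signs: "\<not> (\<forall>i\<in>{1..h}. \<forall>j\<in>{1..h}. sgn (a i) = sgn (a j))" for n
  proof -
    obtain i j where "i \<in> {1..h}" "j \<in> {1..h}" "sgn (a i) \<noteq> sgn (a j)" using signs by blast
    then obtain p q where "p \<in> {1..h}" "a p > 0" "q \<in> {1..h}" "a q < 0"
      using assms(2) by (metis linorder_neqE_linordered_idom sgn_neg sgn_pos)
    then obtain k where "(\<Sum>i\<in>{1..h}. a i * k i) = 0" "\<forall>i\<in>{1..h}. k i \<ge> 1"
      using positive_kernel_vector[of "{1..h}" p a q] by blast
    then show ?thesis using exists_basis[OF assms(2) that(1), of k "{n..}" n] by simp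
  qed
  have signs: "\<not> (\<forall>i\<in>{1..h}. \<forall>j\<in>{1..h}. sgn (a i) = sgn (a j))"
    if basis: "unique_representation_basis h a A" and A: "A \<subseteq> {0..}" for A
  proof
    assume same: "\<forall>i\<in>{1..h}. \<forall>j\<in>{1..h}. sgn (a i) = sgn (a j)"
    define s where "s = sgn (a 1)"
    have s: "s * s = 1" using assms by (auto simp: s_def sgn_if)
    \<comment> \<open>With common sign \<open>s\<close> and nonnegative entries, \<open>s\<close>
      times the form is nonnegative, but a representation of \<open>- s\<close> would make it
      -1.\<close>
    obtain x where x: "x \<in> {1..h} \<rightarrow> A" "(\<Sum>i\<in>{1..h}. a i * x i) = - s"
      using basis by (auto simp only: unique_representation_basis_iff represents_def)
    have "0 \<le> (\<Sum>i\<in>{1..h}. s * (a i * x i))"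
    proof (rule sum_nonneg)
      fix i assume i: "i \<in> {1..h}"
      have "s * a i = \<bar>a i\<bar>"
        using same i assms(1) unfolding s_def by (metis abs_sgn atLeastAtMost_iff le_refl mult.commute)
      moreover have "x i \<ge> 0" using x(1) A i by auto
      ultimately show "0 \<le> s * (a i * x i)" by (simp add: mult.assoc[symmetric])
    qed
    also have "\<dots> = - 1" using x(2) s by (simp add: sum_distrib_left[symmetric])
    finally show False by simp
  qed
  show ?thesis
  proof (intro conjI iffI allI)
    show "primitive_form h a" if "\<exists>A. unique_representation_basis h a A"
      using that prim by blast
    show "\<exists>A. unique_representation_basis h a A" if "primitive_form h a"
      using that by (rule ex)
    show "\<exists>A. unique_representation_basis h a A \<and> A \<subseteq> {n..}"
      if "primitive_form h a \<and> \<not> (\<forall>i\<in>{1..h}. \<forall>j\<in>{1..h}. sgn (a i) = sgn (a j))" for n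
      using ex_pos that by simp
    assume "\<forall>n. \<exists>A. unique_representation_basis h a A \<and> A \<subseteq> {n..}"
    then obtain A where A: "unique_representation_basis h a A" "A \<subseteq> {0..}" by blast
    show "primitive_form h a" by (rule prim[OF A(1)])
    show "\<not> (\<forall>i\<in>{1..h}. \<forall>j\<in>{1..h}. sgn (a i) = sgn (a j))" by (rule signs[OF A])
  qed
qed

end
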